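(* The random graph is not finite sets interpretable in a tree: there is no tree $t$ and no finite sets interpretation $\mathcal{I}$ such that $\mathcal{I}(t)$ is isomorphic to the random graph.
   Context: The random graph is the (unique up to isomorphism) countable undirected unlabeled graph such that for any two disjoint finite sets $E,F$ of vertices there is a vertex $v$ adjacent to all elements of $E$ and to none of $F$. A tree labeled by a finite alphabet $\Sigma$ is a partial mapping $t:\{0,1\}^*\to\Sigma$ with prefix-closed domain such that $u1\in\mathit{dom}(t)$ implies $u0\in\mathit{dom}(t)$; as a structure it has universe $\mathit{dom}(t)$, binary relations $S_i(u,v)\iff v=ui$ ($i=0,1$) and a unary predicate per letter. WMSO is MSO with set variables ranging over finite sets. A finite sets interpretation is a tuple $(\delta(X),\Psi(X,Y))$ of WMSO formulas with free set variables; $\mathcal{I}(t)$ has vertex set the finite $U\subseteq\mathit{dom}(t)$ with $t\models\delta(U)$ and edge relation $\{(U,V): t\models\Psi(U,V)\}$. *)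

theory Defs
  imports Main "HOL-Library.Countable_Set" "HOL-Library.Sublist" "HOL-Library.Nat_Bijection"
begin

section \<open>Labeled trees\<close>

text \<open>Nodes are words over \<open>{0,1}\<close>, with \<^term>\<open>False\<close> for \<open>0\<close> and \<^term>\<open>True\<close> for \<open>1\<close>; the
  word \<open>ui\<close> is \<open>u @ [i]\<close>. The alphabet is the type \<open>'a\<close>, which the theorem takes in class
  \<^class>\<open>finite\<close>. The empty tree is allowed.\<close>

type_synonym node = "bool list"
type_synonym 'a tree = "node \<rightharpoonup> 'a"

definition is_tree :: "'a tree \<Rightarrow> bool" where
  "is_tree t \<longleftrightarrow>
     (\<forall>v \<in> dom t. \<forall>u. prefix u v \<longrightarrow> u \<in> dom t) \<and>
     (\<forall>u. u @ [True] \<in> dom t \<longrightarrow> u @ [False] \<in> dom t)"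

definition succ_rel :: "'a tree \<Rightarrow> bool \<Rightarrow> (node \<times> node) set" where
  "succ_rel t i = {(u, v). u \<in> dom t \<and> v \<in> dom t \<and> v = u @ [i]}"

section \<open>Weak monadic second-order logic on trees\<close>

text \<open>First-order variables and set variables are two separate namespaces, each indexed by
  natural numbers. The remaining connectives and universal quantifiers are definable.\<close>

datatype 'a wmso =
    Eq nat nat            \<comment> \<open>\<open>x = y\<close>, both first-order\<close>
  | Succ bool nat nat     \<comment> \<open>\<open>S\<^sub>i(x, y)\<close>\<close>
  | Label 'a nat          \<comment> \<open>\<open>x\<close> carries the given letter\<close>
  | Mem nat nat           \<comment> \<open>\<open>x \<in> X\<close>, first-order variable first\<close>
  | Neg "'a wmso"
  | Conj "'a wmso" "'a wmso"
  | ExNode nat "'a wmso"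
  | ExSet nat "'a wmso"

fun node_vars :: "'a wmso \<Rightarrow> nat set" where
  "node_vars (Eq x y) = {x, y}"
| "node_vars (Succ i x y) = {x, y}"
| "node_vars (Label a x) = {x}"
| "node_vars (Mem x X) = {x}"
| "node_vars (Neg \<phi>) = node_vars \<phi>"
| "node_vars (Conj \<phi> \<psi>) = node_vars \<phi> \<union> node_vars \<psi>"
| "node_vars (ExNode x \<phi>) = node_vars \<phi> - {x}"
| "node_vars (ExSet X \<phi>) = node_vars \<phi>"

fun set_vars :: "'a wmso \<Rightarrow> nat set" where
  "set_vars (Eq x y) = {}"
| "set_vars (Succ i x y) = {}"
| "set_vars (Label a x) = {}"
| "set_vars (Mem x X) = {X}"
| "set_vars (Neg \<phi>) = set_vars \<phi>"
| "set_vars (Conj \<phi> \<psi>) = set_vars \<phi> \<union> set_vars \<psi>"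
| "set_vars (ExNode x \<phi>) = set_vars \<phi>"
| "set_vars (ExSet X \<phi>) = set_vars \<phi> - {X}"

text \<open>\<^const>\<open>node_vars\<close> and \<^const>\<open>set_vars\<close> collect only the free variables.\<close>

fun sat :: "'a tree \<Rightarrow> (nat \<Rightarrow> node) \<Rightarrow> (nat \<Rightarrow> node set) \<Rightarrow> 'a wmso \<Rightarrow> bool" where
  "sat t e s (Eq x y) \<longleftrightarrow> e x = e y"
| "sat t e s (Succ i x y) \<longleftrightarrow> (e x, e y) \<in> succ_rel t i"
| "sat t e s (Label a x) \<longleftrightarrow> t (e x) = Some a"
| "sat t e s (Mem x X) \<longleftrightarrow> e x \<in> s X"
| "sat t e s (Neg \<phi>) \<longleftrightarrow> \<not> sat t e s \<phi>"
| "sat t e s (Conj \<phi> \<psi>) \<longleftrightarrow> sat t e s \<phi> \<and> sat t e s \<psi>"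
| "sat t e s (ExNode x \<phi>) \<longleftrightarrow> (\<exists>u \<in> dom t. sat t (e(x := u)) s \<phi>)"
| "sat t e s (ExSet X \<phi>) \<longleftrightarrow> (\<exists>U. finite U \<and> U \<subseteq> dom t \<and> sat t e (s(X := U)) \<phi>)"

section \<open>Graphs and the random graph\<close>

type_synonym 'v graph = "'v set \<times> ('v \<times> 'v) set"

definition graph_iso :: "'v graph \<Rightarrow> 'w graph \<Rightarrow> bool" where
  "graph_iso G H \<longleftrightarrow>
     (\<exists>f. bij_betw f (fst G) (fst H) \<and>
          (\<forall>x \<in> fst G. \<forall>y \<in> fst G. (x, y) \<in> snd G \<longleftrightarrow> (f x, f y) \<in> snd H))"

text \<open>Graphs have no loops, as is required for the extension property to determine the
  countable graph up to isomorphism. Taking both sets empty shows that there is a vertex.\<close>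

definition random_graph :: "'v graph \<Rightarrow> bool" where
  "random_graph G \<longleftrightarrow>
     countable (fst G) \<and> snd G \<subseteq> fst G \<times> fst G \<and> sym (snd G) \<and> irrefl (snd G) \<and>
     (\<forall>E F. finite E \<and> finite F \<and> E \<subseteq> fst G \<and> F \<subseteq> fst G \<and> E \<inter> F = {} \<longrightarrow>
        (\<exists>v \<in> fst G. (\<forall>x \<in> E. (v, x) \<in> snd G) \<and> (\<forall>x \<in> F. (v, x) \<notin> snd G)))"

text \<open>The definition is not vacuous: Rado's graph on the natural numbers joins \<open>x < y\<close> iff bit
  \<open>x\<close> of \<open>y\<close> is set.\<close>

lemma random_graph_exists: "\<exists>G :: nat graph. random_graph G"
proof -
  define R :: "(nat \<times> nat) set"
    where "R = {(x, y). (x < y \<and> x \<in> set_decode y) \<or> (y < x \<and> y \<in> set_decode x)}"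
  have ext: "\<exists>v. (\<forall>x \<in> E. (v, x) \<in> R) \<and> (\<forall>x \<in> F. (v, x) \<notin> R)"
    if fin: "finite E" "finite F" and disj: "E \<inter> F = {}" for E F :: "nat set"
  proof -
    define N where "N = Suc (Max (insert 0 (E \<union> F)))"
    have N: "x < N" if "x \<in> E \<union> F" for x
      using that fin unfolding N_def by (simp add: less_Suc_eq_le)
    define v where "v = set_encode (insert N E)"
    have dec: "set_decode v = insert N E"
      using fin unfolding v_def by simp
    have "N < 2 ^ N" by (rule less_exp)
    also have "2 ^ N \<le> v"
      unfolding v_def set_encode_def using fin by (simp add: member_le_sum)
    finally have "N < v" .
    then have lt: "x < v" if "x \<in> E \<union> F" for x
      using N[OF that] by simp
    have "(v, x) \<in> R" if "x \<in> E" for x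
      using that lt[of x] dec by (auto simp: R_def)
    moreover have "(v, x) \<notin> R" if "x \<in> F" for x
      using that lt[of x] N[of x] dec disj by (auto simp: R_def)
    ultimately show ?thesis by blast
  qed
  have "random_graph (UNIV, R)"
    using ext unfolding random_graph_def
    by (auto simp: sym_def irrefl_def R_def)
  then show ?thesis by blast
qed

section \<open>Finite sets interpretations\<close>

text \<open>A pair \<open>(\<delta>(X), \<Psi>(X, Y))\<close>, where \<open>X\<close> and \<open>Y\<close> are the set variables \<open>0\<close> and \<open>1\<close>.\<close>

type_synonym 'a fs_interp = "'a wmso \<times> 'a wmso"

definition finite_sets_interp :: "'a fs_interp \<Rightarrow> bool" where
  "finite_sets_interp I \<longleftrightarrow>
     node_vars (fst I) = {} \<and> set_vars (fst I) \<subseteq> {0} \<and>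
     node_vars (snd I) = {} \<and> set_vars (snd I) \<subseteq> {0, 1}"

text \<open>The default values of the assignments below are irrelevant for pairs of formulas satisfying
  \<^const>\<open>finite_sets_interp\<close>.\<close>

definition interp_verts :: "'a fs_interp \<Rightarrow> 'a tree \<Rightarrow> node set set" where
  "interp_verts I t =
     {U. finite U \<and> U \<subseteq> dom t \<and> sat t (\<lambda>_. []) ((\<lambda>_. {})(0 := U)) (fst I)}"

definition interp_edges :: "'a fs_interp \<Rightarrow> 'a tree \<Rightarrow> (node set \<times> node set) set" where
  "interp_edges I t =
     {(U, V). U \<in> interp_verts I t \<and> V \<in> interp_verts I t \<and>
              sat t (\<lambda>_. []) ((\<lambda>_. {})(0 := U, 1 := V)) (snd I)}"

definition interp_graph :: "'a fs_interp \<Rightarrow> 'a tree \<Rightarrow> node set graph" where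
  "interp_graph I t = (interp_verts I t, interp_edges I t)"

end

theory Submission
  imports Defs "HOL-Library.FuncSet"
begin

text \<open>By the composition method, whether \<open>U\<close> and \<open>V\<close> are adjacent depends, for every depth \<open>n\<close>,
  only on the parts of \<open>U\<close> and \<open>V\<close> above depth \<open>n\<close> and on a summary, one of \<open>c\<close> many, of the
  pair in each subtree rooted at depth \<open>n\<close>; here \<open>c\<close> does not depend on \<open>n\<close>. Start with \<open>N\<close>
  vertices and choose \<open>n\<close> such that all of them live above depth \<open>n\<close>. Vertices separating all
  subsets of these, then vertices separating all subsets of the latter, and so on, form families
  whose sizes are a tower of exponentials over \<open>N\<close>. In each family, the parts below depth \<open>n\<close> can
  be replaced by representatives that behave alike towards the previous family, so the number of
  parts per subtree grows only like a tower over \<open>c\<close>. A vertex is determined by its part above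
  depth \<open>n\<close> and its parts in the subtrees, whose number is fixed, so for \<open>N\<close> large compared with
  \<open>c\<close> the first tower outgrows what the second one permits.\<close>

section \<open>Composition\<close>

definition low :: "nat \<Rightarrow> node set" where
  "low n = {u. length u < n}"

definition sub :: "node \<Rightarrow> node set" where
  "sub v = {u. prefix v u}"

definition level :: "nat \<Rightarrow> node set" where
  "level n = {v. length v = n}"

lemma low_or_sub: "u \<in> low n \<or> (\<exists>v \<in> level n. u \<in> sub v)"
proof (cases "length u < n")
  case False
  then have "take n u \<in> level n" "u \<in> sub (take n u)"
    by (auto simp: level_def sub_def take_is_prefix)
  then show ?thesis by blast
qed (simp add: low_def)

lemma sub_disjoint: "v \<in> level n \<Longrightarrow> w \<in> level n \<Longrightarrow> u \<in> sub v \<Longrightarrow> u \<in> sub w \<Longrightarrow> v = w"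
  by (auto simp: level_def sub_def prefix_def append_eq_append_conv)

lemma low_sub_disjoint: "v \<in> level n \<Longrightarrow> u \<in> sub v \<Longrightarrow> u \<notin> low n"
  by (auto simp: level_def sub_def low_def prefix_def)

lemma finite_level: "finite (level n)"
  using finite_lists_length_eq[of "UNIV :: bool set" n] by (simp add: level_def)

lemma finite_low: "finite (low n)"
proof -
  have "low n = (\<Union>k<n. level k)"
    by (auto simp: low_def level_def)
  then show ?thesis by (simp add: finite_level)
qed

lemma set_eq_by_parts:
  assumes "U \<inter> low n = V \<inter> low n" "\<And>v. v \<in> level n \<Longrightarrow> U \<inter> sub v = V \<inter> sub v"
  shows "U = V"
  using assms low_or_sub[of _ n] by blast

definition glue :: "nat \<Rightarrow> node set \<Rightarrow> (node \<Rightarrow> node set) \<Rightarrow> node set" where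
  "glue n U P = (U \<inter> low n) \<union> (\<Union>v \<in> level n. P v)"

lemma glue_low:
  assumes "\<And>v. v \<in> level n \<Longrightarrow> P v \<subseteq> sub v"
  shows "glue n U P \<inter> low n = U \<inter> low n"
  using assms low_sub_disjoint unfolding glue_def by blast

lemma glue_sub:
  assumes "\<And>v. v \<in> level n \<Longrightarrow> P v \<subseteq> sub v" "v \<in> level n"
  shows "glue n U P \<inter> sub v = P v"
  using assms low_sub_disjoint sub_disjoint unfolding glue_def by blast

lemma glue_subset:
  assumes "U \<subseteq> D" "\<And>v. v \<in> level n \<Longrightarrow> P v \<subseteq> D"
  shows "glue n U P \<subseteq> D"
  using assms unfolding glue_def by blast

lemma finite_glue:
  assumes "\<And>v. v \<in> level n \<Longrightarrow> finite (P v)"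
  shows "finite (glue n U P)"
  using assms finite_level finite_low unfolding glue_def by blast

text \<open>A node variable enters a summary as a singleton, or as the empty set when its value lies
  outside the subtree under consideration.\<close>

type_synonym summary = "node \<Rightarrow> (nat \<Rightarrow> node set) \<Rightarrow> (nat \<Rightarrow> node set) \<Rightarrow> nat"

text \<open>Locality is built in here: \<open>f\<close> may be any function, but besides
  \<open>v\<close> it is handed only traces on \<open>sub v\<close>.\<close>

definition summary_at :: "summary \<Rightarrow> node \<Rightarrow> (nat \<Rightarrow> node) \<Rightarrow> (nat \<Rightarrow> node set) \<Rightarrow> nat" where
  "summary_at f v e s = f v (\<lambda>x. {e x} \<inter> sub v) (\<lambda>X. s X \<inter> sub v)"

text \<open>The equation between singleton traces leaves two options for a node variable: its values
  agree, or both lie outside \<open>low n\<close>, where only the summaries compare them.\<close>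

definition indist :: "nat \<Rightarrow> summary \<Rightarrow> (nat \<Rightarrow> node) \<Rightarrow> (nat \<Rightarrow> node set) \<Rightarrow>
    (nat \<Rightarrow> node) \<Rightarrow> (nat \<Rightarrow> node set) \<Rightarrow> bool" where
  "indist n f e s e' s' \<longleftrightarrow>
     (\<forall>x. {e x} \<inter> low n = {e' x} \<inter> low n) \<and> (\<forall>X. s X \<inter> low n = s' X \<inter> low n) \<and>
     (\<forall>v \<in> level n. summary_at f v e s = summary_at f v e' s')"

lemma indist_sym: "indist n f e s e' s' \<Longrightarrow> indist n f e' s' e s"
  by (simp add: indist_def)

lemma indist_low:
  assumes "indist n f e s e' s'"
  shows "e x \<in> low n \<Longrightarrow> e' x = e x" "u \<in> low n \<Longrightarrow> u \<in> s X \<longleftrightarrow> u \<in> s' X"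
proof -
  have *: "{e x} \<inter> low n = {e' x} \<inter> low n" "s X \<inter> low n = s' X \<inter> low n"
    using assms by (simp_all add: indist_def)
  show "e' x = e x" if "e x \<in> low n"
  proof -
    have "e x \<in> {e' x} \<inter> low n" unfolding *(1)[symmetric] using that by simp
    then show ?thesis by simp
  qed
  show "u \<in> low n \<Longrightarrow> u \<in> s X \<longleftrightarrow> u \<in> s' X" using *(2) by blast
qed

text \<open>The finite range \<open>C\<close> must not depend on the depth \<open>n\<close>.\<close>

definition summarizes :: "'a tree \<Rightarrow> 'a wmso \<Rightarrow> nat set \<Rightarrow> summary \<Rightarrow> bool" where
  "summarizes t \<phi> C f \<longleftrightarrow> finite C \<and> (\<forall>v p s. f v p s \<in> C) \<and>
     (\<forall>n e s e' s'. indist n f e s e' s' \<longrightarrow> sat t e s \<phi> \<longleftrightarrow> sat t e' s' \<phi>)"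

lemma summarizesI:
  assumes "finite C" "\<And>v p s. f v p s \<in> C"
    "\<And>n e s e' s'. indist n f e s e' s' \<Longrightarrow> sat t e s \<phi> \<Longrightarrow> sat t e' s' \<phi>"
  shows "summarizes t \<phi> C f"
  unfolding summarizes_def using assms indist_sym by blast

lemma summarizesD:
  "summarizes t \<phi> C f \<Longrightarrow> indist n f e s e' s' \<Longrightarrow> sat t e s \<phi> \<longleftrightarrow> sat t e' s' \<phi>"
  unfolding summarizes_def by blast

section \<open>Summaries of atomic formulas\<close>

lemma summarizes_Eq: "\<exists>C f. summarizes t (Eq x y) C f"
proof (intro exI, rule summarizesI)
  define f :: summary where "f = (\<lambda>v p s. of_bool (p x \<inter> p y \<noteq> {}))"
  show "finite {0, 1 :: nat}" "\<And>v p s. f v p s \<in> {0, 1}"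
    by (auto simp: f_def)
  fix n e s e' s'
  assume ind: "indist n f e s e' s'" and sat: "sat t e s (Eq x y)"
  then have eq: "e x = e y" by simp
  have "e' x = e' y"
  proof (cases "e x \<in> low n")
    case True
    then show ?thesis using indist_low(1)[OF ind] eq by metis
  next
    case False
    then obtain v where v: "v \<in> level n" "e x \<in> sub v" using low_or_sub by blast
    then have "summary_at f v e s = summary_at f v e' s'" using ind by (simp add: indist_def)
    \<comment> \<open>The bit is 1 for \<open>e\<close>, hence for \<open>e'\<close>, and traces of
      two singletons meet only if they come from the same node.\<close>
    then show ?thesis using v eq by (auto simp: summary_at_def f_def of_bool_def split: if_splits)
  qed
  then show "sat t e' s' (Eq x y)" by simp
qed

lemma summarizes_Mem: "\<exists>C f. summarizes t (Mem x X) C f"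
proof (intro exI, rule summarizesI)
  define f :: summary where "f = (\<lambda>v p s. of_bool (p x \<inter> s X \<noteq> {}))"
  show "finite {0, 1 :: nat}" "\<And>v p s. f v p s \<in> {0, 1}"
    by (auto simp: f_def)
  fix n e s e' s'
  assume ind: "indist n f e s e' s'" and sat: "sat t e s (Mem x X)"
  then have mem: "e x \<in> s X" by simp
  have "e' x \<in> s' X"
  proof (cases "e x \<in> low n")
    case True
    then show ?thesis using indist_low[OF ind] mem by metis
  next
    case False
    then obtain v where v: "v \<in> level n" "e x \<in> sub v" using low_or_sub by blast
    then have "summary_at f v e s = summary_at f v e' s'" using ind by (simp add: indist_def)
    then show ?thesis using v mem by (auto simp: summary_at_def f_def of_bool_def split: if_splits)
  qed
  then show "sat t e' s' (Mem x X)" by simp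
qed

lemma summarizes_Label: "\<exists>C f. summarizes t (Label a x) C f"
proof (intro exI, rule summarizesI)
  define f :: summary where "f = (\<lambda>v p s. of_bool (\<exists>u \<in> p x. t u = Some a))"
  show "finite {0, 1 :: nat}" "\<And>v p s. f v p s \<in> {0, 1}"
    by (auto simp: f_def)
  fix n e s e' s'
  assume ind: "indist n f e s e' s'" and sat: "sat t e s (Label a x)"
  then have lab: "t (e x) = Some a" by simp
  have "t (e' x) = Some a"
  proof (cases "e x \<in> low n")
    case True
    then show ?thesis using indist_low(1)[OF ind] lab by metis
  next
    case False
    then obtain v where v: "v \<in> level n" "e x \<in> sub v" using low_or_sub by blast
    then have "summary_at f v e s = summary_at f v e' s'" using ind by (simp add: indist_def)
    then show ?thesis using v lab by (auto simp: summary_at_def f_def of_bool_def split: if_splits)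
  qed
  then show "sat t e' s' (Label a x)" by simp
qed

text \<open>An edge may cross from \<open>low n\<close> into a subtree, and then no subtree sees
  both ends. Its lower end is then the root of the subtree, so a second bit records whether
  \<open>y\<close> is that root; the upper end is fixed by the agreement on
  \<open>low n\<close>.\<close>

lemma summarizes_Succ: "\<exists>C f. summarizes t (Succ i x y) C f"
proof (intro exI, rule summarizesI)
  define f :: summary where
    "f = (\<lambda>v p s. of_bool (p x \<times> p y \<inter> succ_rel t i \<noteq> {}) + 2 * of_bool (v \<in> p y))"
  show "finite {0, 1, 2, 3 :: nat}" "\<And>v p s. f v p s \<in> {0, 1, 2, 3}"
    by (auto simp: f_def)
  fix n e s e' s'
  assume ind: "indist n f e s e' s'" and sat: "sat t e s (Succ i x y)"
  then have succ: "(e x, e y) \<in> succ_rel t i" by simp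
  then have ey: "e y = e x @ [i]" by (simp add: succ_rel_def)
  have eq: "f v (\<lambda>x. {e x} \<inter> sub v) (\<lambda>X. s X \<inter> sub v)
      = f v (\<lambda>x. {e' x} \<inter> sub v) (\<lambda>X. s' X \<inter> sub v)" if "v \<in> level n" for v
    using ind that by (simp add: indist_def summary_at_def)
  have bits: "a = c \<and> b = d" if "of_bool a + 2 * of_bool b = (of_bool c + 2 * of_bool d :: nat)" for a b c d
    using that by (auto simp: of_bool_def split: if_splits)
  have "(e' x, e' y) \<in> succ_rel t i"
  proof (cases "e y \<in> low n")
    case True
    then have "e x \<in> low n" using ey by (simp add: low_def)
    then show ?thesis using True indist_low(1)[OF ind] succ by metis
  next
    case False
    then obtain v where v: "v \<in> level n" "e y \<in> sub v" using low_or_sub by blast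
    note b = bits[OF eq[OF v(1), unfolded f_def]]
    show ?thesis
    proof (cases "e x \<in> low n")
      case True
      then have "\<not> prefix v (e x)" using v(1) prefix_length_le[of v "e x"]
        by (auto simp: low_def level_def)
      then have "e y = v" using v(2) ey by (simp add: sub_def)
      moreover have "v \<in> sub v" by (simp add: sub_def)
      ultimately have "e' y = v" using b by auto
      then show ?thesis using \<open>e y = v\<close> succ indist_low(1)[OF ind True] by simp
    next
      case False
      then have "v \<noteq> e y" using v(1) ey by (auto simp: low_def level_def)
      then have "e x \<in> sub v" using v(2) ey by (simp add: sub_def)
      then show ?thesis using v succ b by auto
    qed
  qed
  then show "sat t e' s' (Succ i x y)" by simp
qed

section \<open>Summaries of connectives and quantifiers\<close>

lemma summarizes_Neg: "summarizes t \<phi> C f \<Longrightarrow> summarizes t (Neg \<phi>) C f"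
  by (simp add: summarizes_def)

lemma summarizes_Conj:
  assumes "summarizes t \<phi> C f" "summarizes t \<psi> D g"
  shows "\<exists>C f. summarizes t (Conj \<phi> \<psi>) C f"
proof (intro exI, rule summarizesI)
  define h :: summary where "h = (\<lambda>v p s. prod_encode (f v p s, g v p s))"
  show "finite (prod_encode ` (C \<times> D))" "\<And>v p s. h v p s \<in> prod_encode ` (C \<times> D)"
    using assms by (auto simp: summarizes_def h_def)
  fix n e s e' s'
  assume ind: "indist n h e s e' s'" and sat: "sat t e s (Conj \<phi> \<psi>)"
  then have "indist n f e s e' s'" "indist n g e s e' s'"
    by (auto simp: indist_def summary_at_def h_def)
  then show "sat t e' s' (Conj \<phi> \<psi>)"
    using sat assms summarizesD by (metis sat.simps(6))
qed

lemma fun_upd_Int: "(\<lambda>X. (s(X0 := U)) X \<inter> T) = (\<lambda>X. s X \<inter> T)(X0 := U \<inter> T)"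
  by (auto simp: fun_eq_iff)

lemma fun_upd_singleton_Int:
  "(\<lambda>x. {(e(x0 := u)) x} \<inter> T) = (\<lambda>x. {e x} \<inter> T)(x0 := {u} \<inter> T)"
  by (auto simp: fun_eq_iff)

text \<open>The new summary collects the values that \<open>f\<close> takes as the part of
  \<open>X\<close> in the subtree varies. Parts in different subtrees can be chosen independently,
  so a witness is transferred subtree by subtree and glued together. The new range, a coding of
  \<open>Pow C\<close>, is again independent of the depth.\<close>

lemma summarizes_ExSet:
  assumes "summarizes t \<phi> C f"
  shows "\<exists>C f. summarizes t (ExSet X \<phi>) C f"
proof (intro exI, rule summarizesI)
  define W where "W v = {U. finite U \<and> U \<subseteq> dom t \<and> U \<subseteq> sub v}" for v
  define F where "F v p s = (\<lambda>U. f v p (s(X := U))) ` W v" for v p s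
  define h :: summary where "h = (\<lambda>v p s. set_encode (F v p s))"
  have sub: "F v p s \<subseteq> C" and C: "finite C" for v p s
    using assms by (auto simp: summarizes_def F_def)
  show "finite (set_encode ` Pow C)" "\<And>v p s. h v p s \<in> set_encode ` Pow C"
    using sub C by (auto simp: h_def)
  fix n e s e' s'
  assume ind: "indist n h e s e' s'" and sat: "sat t e s (ExSet X \<phi>)"
  then obtain U where U: "finite U" "U \<subseteq> dom t" "sat t e (s(X := U)) \<phi>" by auto
  let ?p = "\<lambda>e v x. {e x :: node} \<inter> sub v" and ?s = "\<lambda>s v X. (s X :: node set) \<inter> sub v"
  have "\<exists>P \<in> W v. f v (?p e v) ((?s s v)(X := U \<inter> sub v)) = f v (?p e' v) ((?s s' v)(X := P))"
    if "v \<in> level n" for v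
  proof -
    have "h v (?p e v) (?s s v) = h v (?p e' v) (?s s' v)"
      using ind that by (simp add: indist_def summary_at_def)
    then have "F v (?p e v) (?s s v) = F v (?p e' v) (?s s' v)"
      \<comment> \<open>\<open>set_encode\<close> is injective only on finite sets, which the
        inclusion in \<open>C\<close> provides.\<close>
      using sub C by (metis h_def set_encode_inverse finite_subset)
    moreover have "U \<inter> sub v \<in> W v" using U by (auto simp: W_def)
    ultimately show ?thesis unfolding F_def by blast
  qed
  then obtain P where P: "\<And>v. v \<in> level n \<Longrightarrow> P v \<in> W v"
    "\<And>v. v \<in> level n \<Longrightarrow>
      f v (?p e v) ((?s s v)(X := U \<inter> sub v)) = f v (?p e' v) ((?s s' v)(X := P v))"
    by metis
  define U' where "U' = glue n U P"
  have U': "finite U'" "U' \<subseteq> dom t"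
  proof -
    show "finite U'" using P(1) unfolding U'_def W_def by (intro finite_glue) blast
    show "U' \<subseteq> dom t" using P(1) U unfolding U'_def W_def by (intro glue_subset) blast+
  qed
  have low: "U' \<inter> low n = U \<inter> low n" and subv: "\<And>v. v \<in> level n \<Longrightarrow> U' \<inter> sub v = P v"
    using P(1) unfolding U'_def W_def by (auto intro!: glue_low glue_sub)
  have "indist n f e (s(X := U)) e' (s'(X := U'))"
    using ind low P(2) unfolding indist_def summary_at_def fun_upd_Int by (auto simp: subv)
  then show "sat t e' s' (ExSet X \<phi>)"
    using assms U U' summarizesD by fastforce
qed

text \<open>A node witness lies in at most one subtree at depth \<open>n\<close>, and all others see
  the empty trace. Besides the values of \<open>f\<close> for witnesses inside the subtree, the
  summary therefore records its value for \<open>x\<close> lying elsewhere.\<close>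

lemma summarizes_ExNode:
  assumes "summarizes t \<phi> C f"
  shows "\<exists>C f. summarizes t (ExNode x \<phi>) C f"
proof (intro exI, rule summarizesI)
  define F where "F v p s = (\<lambda>u. f v (p(x := {u})) s) ` (dom t \<inter> sub v)" for v p s
  define h :: summary where
    "h = (\<lambda>v p s. prod_encode (set_encode (F v p s), f v (p(x := {})) s))"
  have sub: "F v p s \<subseteq> C" and C: "finite C" and fC: "f v p s \<in> C" for v p s
    using assms by (auto simp: summarizes_def F_def)
  show "finite (prod_encode ` (set_encode ` Pow C \<times> C))"
    "\<And>v p s. h v p s \<in> prod_encode ` (set_encode ` Pow C \<times> C)"
    using sub C fC by (auto simp: h_def)
  fix n e s e' s'
  assume ind: "indist n h e s e' s'" and sat: "sat t e s (ExNode x \<phi>)"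
  then obtain u where u: "u \<in> dom t" "sat t (e(x := u)) s \<phi>" by auto
  let ?p = "\<lambda>e v x. {e x :: node} \<inter> sub v" and ?s = "\<lambda>s v X. (s X :: node set) \<inter> sub v"
  have h: "h v (?p e v) (?s s v) = h v (?p e' v) (?s s' v)" if "v \<in> level n" for v
    using ind that by (simp add: indist_def summary_at_def)
  then have out: "f v ((?p e v)(x := {})) (?s s v) = f v ((?p e' v)(x := {})) (?s s' v)"
    if "v \<in> level n" for v using that by (simp add: h_def)
  have F: "F v (?p e v) (?s s v) = F v (?p e' v) (?s s' v)" if "v \<in> level n" for v
  proof -
    have "set_encode (F v (?p e v) (?s s v)) = set_encode (F v (?p e' v) (?s s' v))"
      using h[OF that] by (simp add: h_def)
    then show ?thesis using sub C by (metis set_encode_inverse finite_subset)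
  qed
  have "\<exists>u' \<in> dom t. indist n f (e(x := u)) s (e'(x := u')) s'"
  proof (cases "u \<in> low n")
    case True
    then have "{u} \<inter> sub v = {}" if "v \<in> level n" for v
      using low_sub_disjoint that by blast
    then have "indist n f (e(x := u)) s (e'(x := u)) s'"
      using ind out unfolding indist_def summary_at_def fun_upd_singleton_Int by auto
    then show ?thesis using u by blast
  next
    case False
    then obtain w where w: "w \<in> level n" "u \<in> sub w" using low_or_sub by blast
    \<comment> \<open>The replacement is taken from the same subtree \<open>w\<close>, so that all
      others keep seeing the empty trace.\<close>
    then have "f w ((?p e w)(x := {u})) (?s s w) \<in> F w (?p e' w) (?s s' w)"
      using F[OF w(1)] u unfolding F_def by blast
    then obtain u' where u': "u' \<in> dom t" "u' \<in> sub w"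
      "f w ((?p e w)(x := {u})) (?s s w) = f w ((?p e' w)(x := {u'})) (?s s' w)"
      unfolding F_def by auto
    have "u' \<notin> low n" using u' w low_sub_disjoint by blast
    moreover have "f v ((?p e v)(x := {u} \<inter> sub v)) (?s s v)
        = f v ((?p e' v)(x := {u'} \<inter> sub v)) (?s s' v)" if "v \<in> level n" for v
    proof (cases "v = w")
      case True
      then show ?thesis using u' w by simp
    next
      case False
      then have "{u} \<inter> sub v = {}" "{u'} \<inter> sub v = {}"
        using sub_disjoint[OF that w(1)] w u' by auto
      then show ?thesis using out[OF that] by simp
    qed
    ultimately have "indist n f (e(x := u)) s (e'(x := u')) s'"
      using ind False unfolding indist_def summary_at_def fun_upd_singleton_Int by auto
    then show ?thesis using u' by blast
  qed
  then show "sat t e' s' (ExNode x \<phi>)"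
    using assms u summarizesD by (metis sat.simps(7))
qed

lemma ex_summary: "\<exists>C f. summarizes t \<phi> C f"
proof (induction \<phi>)
  case (Neg \<phi>)
  then show ?case using summarizes_Neg by blast
next
  case (Conj \<phi> \<psi>)
  then show ?case using summarizes_Conj by blast
next
  case (ExNode x \<phi>)
  then show ?case using summarizes_ExNode by blast
next
  case (ExSet X \<phi>)
  then show ?case using summarizes_ExSet by blast
qed (rule summarizes_Eq summarizes_Succ summarizes_Label summarizes_Mem)+

section \<open>Transfer to the interpreted graph\<close>

text \<open>Pairing summaries of the vertex and the edge formula lets one \<open>g\<close> control
  membership and adjacency. Only the first set is exchanged, since vertices will be normalized
  against a fixed earlier family.\<close>

lemma interp_composition:
  obtains C :: "nat set" and g :: "node \<Rightarrow> node set \<Rightarrow> node set \<Rightarrow> nat"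
  where "finite C" "\<And>v P Q. g v P Q \<in> C"
    "\<And>n U U' V. finite U' \<Longrightarrow> U' \<subseteq> dom t \<Longrightarrow> U \<in> interp_verts I t \<Longrightarrow>
       U \<inter> low n = U' \<inter> low n \<Longrightarrow>
       (\<And>v. v \<in> level n \<Longrightarrow> g v (U \<inter> sub v) (V \<inter> sub v) = g v (U' \<inter> sub v) (V \<inter> sub v)) \<Longrightarrow>
       U' \<in> interp_verts I t \<and> ((U, V) \<in> interp_edges I t \<longleftrightarrow> (U', V) \<in> interp_edges I t)"
proof -
  obtain C f where f: "summarizes t (fst I) C f" using ex_summary by blast
  obtain D h where h: "summarizes t (snd I) D h" using ex_summary by blast
  define p where "p v = (\<lambda>x :: nat. {[]} \<inter> sub v)" for v
  define g where "g v P Q = prod_encode (f v (p v) ((\<lambda>_. {})(0 := P)),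
    h v (p v) ((\<lambda>_. {})(0 := P, 1 := Q)))" for v P Q
  have upd1: "(\<lambda>X. ((\<lambda>_. {})(0 := U)) X \<inter> T) = (\<lambda>_. {})(0 := U \<inter> T)"
    and upd2: "(\<lambda>X. ((\<lambda>_. {})(0 := U, 1 := V)) X \<inter> T) = (\<lambda>_. {})(0 := U \<inter> T, 1 := V \<inter> T)"
    for U V T :: "node set" by (auto simp: fun_eq_iff)
  show ?thesis
  proof (rule that)
    show "finite (prod_encode ` (C \<times> D))" "\<And>v P Q. g v P Q \<in> prod_encode ` (C \<times> D)"
      using f h by (auto simp: summarizes_def g_def)
    fix n U U' V
    assume U': "finite U'" "U' \<subseteq> dom t" and U: "U \<in> interp_verts I t"
      and low: "U \<inter> low n = U' \<inter> low n"
      and eq: "\<And>v. v \<in> level n \<Longrightarrow> g v (U \<inter> sub v) (V \<inter> sub v) = g v (U' \<inter> sub v) (V \<inter> sub v)"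
    have "indist n f (\<lambda>_. []) ((\<lambda>_. {})(0 := U)) (\<lambda>_. []) ((\<lambda>_. {})(0 := U'))"
      using low eq unfolding indist_def summary_at_def upd1 g_def p_def by auto
    then have 1: "U' \<in> interp_verts I t"
      using U U' summarizesD[OF f] unfolding interp_verts_def by blast
    have "indist n h (\<lambda>_. []) ((\<lambda>_. {})(0 := U, 1 := V)) (\<lambda>_. []) ((\<lambda>_. {})(0 := U', 1 := V))"
      using low eq unfolding indist_def summary_at_def upd2 g_def p_def by auto
    then have "(U, V) \<in> interp_edges I t \<longleftrightarrow> (U', V) \<in> interp_edges I t"
      using U 1 summarizesD[OF h] unfolding interp_edges_def by blast
    with 1 show "U' \<in> interp_verts I t \<and> ((U, V) \<in> interp_edges I t \<longleftrightarrow> (U', V) \<in> interp_edges I t)"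
      by blast
  qed
qed

section \<open>Two towers\<close>

text \<open>Bounds the parts per subtree. At first only the empty part occurs; later, with at most
  \<open>2 ^ d\<close> values of \<open>g\<close>, there are at most \<open>2 ^ (d * r)\<close>
  behaviours towards \<open>r\<close> parts.\<close>

fun part_tower :: "nat \<Rightarrow> nat \<Rightarrow> nat" where
  "part_tower d 0 = 1"
| "part_tower d (Suc k) = 2 ^ (d * part_tower d k)"

fun vert_tower :: "nat \<Rightarrow> nat \<Rightarrow> nat" where
  "vert_tower N 0 = N"
| "vert_tower N (Suc k) = 2 ^ vert_tower N k"

text \<open>The slack \<open>d + k + 2\<close> carries the induction: exponentiation turns it into a
  factor \<open>2 ^ (d + k + 2)\<close>, which absorbs both the factor \<open>d\<close> and the next
  slack. For \<open>k = 0\<close> both sides are equal, which explains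
  \<open>2 * d + 2\<close>.\<close>

lemma vert_tower_ge:
  "d * part_tower d k + d + k + 2 \<le> vert_tower (2 * d + 2) k"
proof (induction k)
  case (Suc k)
  define r m V where "r = part_tower d (Suc k)" and "m = d + Suc k + 2"
    and "V = vert_tower (2 * d + 2) (Suc k)"
  have r: "r = 2 ^ (d * part_tower d k)" by (simp add: r_def)
  then have "1 \<le> r" by simp
  then have "m \<le> r * m" by simp
  have "d + k < 2 ^ (d + k)" by (rule less_exp)
  moreover have "(2 :: nat) ^ (d + k + 2) = 4 * 2 ^ (d + k)" by (simp add: power_add)
  ultimately have "d + m \<le> 2 ^ (d + k + 2)" unfolding m_def by linarith
  then have "r * (d + m) \<le> r * 2 ^ (d + k + 2)"
    by (rule mult_le_mono2)
  also have "\<dots> = 2 ^ (d * part_tower d k + d + k + 2)"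
    unfolding r by (simp only: power_add mult.assoc)
  also have "\<dots> \<le> V"
    unfolding V_def vert_tower.simps using Suc by (rule power_increasing) simp
  finally have "d * r + r * m \<le> V"
    by (simp only: distrib_left mult.commute)
  with \<open>m \<le> r * m\<close> have "d * r + m \<le> V" by linarith
  then show ?case unfolding r_def m_def V_def by (simp only: add.assoc)
qed simp

text \<open>Here \<open>a\<close> and \<open>b\<close> stand for the numbers of words shorter than
  \<open>n\<close> and of length \<open>n\<close>. At height \<open>k + 2\<close>, the exponent on
  the left is linear in \<open>r = part_tower d (k + 1)\<close>, while by the slack in
  \<open>vert_tower_ge\<close> the exponent on the right is at least
  \<open>2 ^ k * r\<close>.\<close>

lemma vert_tower_dominates:
  "\<exists>k. 2 ^ a * part_tower d k ^ b < vert_tower (2 * d + 2) k"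
proof
  \<comment> \<open>Chosen such that \<open>a + d * b * r \<le> k * r\<close> whenever
    \<open>r\<close> is positive.\<close>
  define k where "k = a + d * b"
  define r where "r = part_tower d (Suc k)"
  have r: "r = 2 ^ (d * part_tower d k)" by (simp add: r_def)
  then have "1 \<le> r" by simp
  then have "a + d * b * r \<le> k * r"
    unfolding k_def by (simp add: distrib_right)
  also have "k * r < 2 ^ k * r"
    using less_exp[of k] \<open>1 \<le> r\<close> by (intro mult_strict_right_mono) auto
  also have "\<dots> = 2 ^ (d * part_tower d k + k)"
    unfolding r by (simp only: power_add mult.commute)
  also have "\<dots> \<le> vert_tower (2 * d + 2) (Suc k)"
    unfolding vert_tower.simps using vert_tower_ge[of d k] by (intro power_increasing) linarith+
  finally have "(2 :: nat) ^ (a + d * b * r) < 2 ^ vert_tower (2 * d + 2) (Suc k)"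
    by (rule power_strict_increasing) simp
  moreover have "2 ^ a * (2 ^ (d * r)) ^ b = (2 :: nat) ^ (a + d * b * r)"
    by (simp only: power_add power_mult[symmetric] mult.assoc mult.commute[of r b])
  ultimately show "2 ^ a * part_tower d (Suc (Suc k)) ^ b < vert_tower (2 * d + 2) (Suc (Suc k))"
    unfolding part_tower.simps(2)[of d "Suc k"] vert_tower.simps(2)[of _ "Suc k"] r_def[symmetric]
    by simp
qed

section \<open>Counting and normalizing vertices\<close>

lemma card_le_of_parts:
  assumes R: "\<And>v. v \<in> level n \<Longrightarrow> finite (R v) \<and> card (R v) \<le> r"
    and E: "\<And>U v. U \<in> E \<Longrightarrow> v \<in> level n \<Longrightarrow> U \<inter> sub v \<in> R v"
  shows "card E \<le> 2 ^ card (low n) * r ^ card (level n)"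
proof -
  let ?S = "Pow (low n) \<times> Pi\<^sub>E (level n) R"
  define \<kappa> where "\<kappa> U = (U \<inter> low n, restrict (\<lambda>v. U \<inter> sub v) (level n))" for U
  have "inj_on \<kappa> E"
  proof (rule inj_onI)
    fix U V assume "\<kappa> U = \<kappa> V"
    then have low: "U \<inter> low n = V \<inter> low n"
      and eq: "restrict (\<lambda>v. U \<inter> sub v) (level n) = restrict (\<lambda>v. V \<inter> sub v) (level n)"
      by (auto simp: \<kappa>_def)
    show "U = V" using low
    proof (rule set_eq_by_parts)
      show "U \<inter> sub v = V \<inter> sub v" if "v \<in> level n" for v
        using fun_cong[OF eq, of v] that by simp
    qed
  qed
  moreover have "\<kappa> ` E \<subseteq> ?S" using E by (auto simp: \<kappa>_def)
  moreover have "finite ?S" using R by (intro finite_SigmaI finite_PiE finite_level) (auto simp: finite_low)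
  ultimately have "card E \<le> card ?S" by (rule card_inj_on_le)
  also have "\<dots> = 2 ^ card (low n) * (\<Prod>v \<in> level n. card (R v))"
    by (simp add: card_cartesian_product card_Pow finite_low card_PiE finite_level)
  also have "(\<Prod>v \<in> level n. card (R v)) \<le> r ^ card (level n)"
    using prod_mono[of "level n" "\<lambda>v. card (R v)" "\<lambda>_. r"] R by simp
  finally show ?thesis by simp
qed

text \<open>The extension property with \<open>F = E - S\<close>: in the sense of Vapnik and
  Chervonenkis, neighbourhoods shatter every finite set of vertices.\<close>

definition shattering :: "'v graph \<Rightarrow> bool" where
  "shattering G \<longleftrightarrow> (\<forall>E S. finite E \<longrightarrow> E \<subseteq> fst G \<longrightarrow> S \<subseteq> E \<longrightarrow>
     (\<exists>v \<in> fst G. \<forall>x \<in> E. (v, x) \<in> snd G \<longleftrightarrow> x \<in> S))"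

text \<open>One step of the tower: the shattering vertices are normalized below depth \<open>n\<close> to
  representatives, which are indexed by the values of \<open>g\<close> against the parts in \<open>R v\<close>.\<close>

lemma shattering_step:
  assumes shat: "shattering (interp_graph I t)"
    and C: "finite C" "card C \<le> 2 ^ d" and gC: "\<And>v P Q. g v P Q \<in> C"
    and comp: "\<And>U U' V. finite U' \<Longrightarrow> U' \<subseteq> dom t \<Longrightarrow> U \<in> interp_verts I t \<Longrightarrow>
       U \<inter> low n = U' \<inter> low n \<Longrightarrow>
       (\<And>v. v \<in> level n \<Longrightarrow> g v (U \<inter> sub v) (V \<inter> sub v) = g v (U' \<inter> sub v) (V \<inter> sub v)) \<Longrightarrow>
       U' \<in> interp_verts I t \<and> ((U, V) \<in> interp_edges I t \<longleftrightarrow> (U', V) \<in> interp_edges I t)"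
    and E: "finite E" "E \<subseteq> interp_verts I t" "E \<noteq> {}"
    and R: "\<And>v. v \<in> level n \<Longrightarrow> finite (R v) \<and> card (R v) \<le> r"
    and ER: "\<And>U v. U \<in> E \<Longrightarrow> v \<in> level n \<Longrightarrow> U \<inter> sub v \<in> R v"
  shows "\<exists>E' R'. finite E' \<and> E' \<subseteq> interp_verts I t \<and> card E' = 2 ^ card E \<and>
    (\<forall>v \<in> level n. finite (R' v) \<and> card (R' v) \<le> 2 ^ (d * r)) \<and>
    (\<forall>U \<in> E'. \<forall>v \<in> level n. U \<inter> sub v \<in> R' v)"
proof -
  define W where "W v = {P. finite P \<and> P \<subseteq> dom t \<and> P \<subseteq> sub v}" for v
  define sig where "sig v P = restrict (g v P) (R v)" for v P
  \<comment> \<open>The inverse depends on \<open>P\<close> only through its signature, so there are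
    no more representatives than signatures, even if \<open>W v\<close> is infinite.\<close>
  define rep where "rep v P = inv_into (W v) (sig v) (sig v P)" for v P
  have rep: "rep v P \<in> W v" "sig v (rep v P) = sig v P" if "P \<in> W v" for v P
    using that unfolding rep_def by (auto intro: inv_into_into f_inv_into_f)
  define R' where "R' v = rep v ` W v" for v
  have R': "finite (R' v) \<and> card (R' v) \<le> 2 ^ (d * r)" if v: "v \<in> level n" for v
  proof -
    have sub: "R' v \<subseteq> inv_into (W v) (sig v) ` Pi\<^sub>E (R v) (\<lambda>_. C)"
      using gC unfolding R'_def rep_def sig_def by auto
    have fin: "finite (Pi\<^sub>E (R v) (\<lambda>_. C))"
      using R[OF v] C by (intro finite_PiE) auto
    have "card (R' v) \<le> card (Pi\<^sub>E (R v) (\<lambda>_. C))"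
      using fin sub by (rule surj_card_le)
    also have "\<dots> = card C ^ card (R v)" using R[OF v] by (simp add: card_PiE)
    also have "\<dots> \<le> (2 ^ d) ^ card (R v)" using C(2) by (rule power_mono) simp
    also have "\<dots> \<le> (2 ^ d) ^ r" using R[OF v] by (intro power_increasing) auto
    finally show ?thesis using finite_surj[OF fin sub] by (simp add: power_mult)
  qed
  have "\<exists>w \<in> interp_verts I t. (\<forall>v \<in> level n. w \<inter> sub v \<in> R' v) \<and>
      (\<forall>V \<in> E. (w, V) \<in> interp_edges I t \<longleftrightarrow> V \<in> S)" if S: "S \<subseteq> E" for S
  proof -
    obtain U where U: "U \<in> interp_verts I t" "\<forall>V \<in> E. (U, V) \<in> interp_edges I t \<longleftrightarrow> V \<in> S"
      using shat E S unfolding shattering_def interp_graph_def fst_conv snd_conv by metis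
    define U' where "U' = glue n U (\<lambda>v. rep v (U \<inter> sub v))"
    have UW: "U \<inter> sub v \<in> W v" for v using U(1) by (auto simp: W_def interp_verts_def)
    have repW: "rep v (U \<inter> sub v) \<in> W v" for v using rep(1)[OF UW] .
    have fin: "finite U'" "U' \<subseteq> dom t"
    proof -
      show "finite U'" using repW unfolding U'_def W_def by (intro finite_glue) blast
      show "U' \<subseteq> dom t"
        using repW U(1) unfolding U'_def W_def interp_verts_def by (intro glue_subset) blast+
    qed
    have low: "U \<inter> low n = U' \<inter> low n"
      and subv: "\<And>v. v \<in> level n \<Longrightarrow> U' \<inter> sub v = rep v (U \<inter> sub v)"
      using repW unfolding U'_def W_def by (auto intro!: glue_low[symmetric] glue_sub)
    have key: "U' \<in> interp_verts I t \<and> ((U, V) \<in> interp_edges I t \<longleftrightarrow> (U', V) \<in> interp_edges I t)"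
      if "V \<in> E" for V
    proof (rule comp[OF fin U(1) low])
      fix v assume v: "v \<in> level n"
      have "sig v (U' \<inter> sub v) = sig v (U \<inter> sub v)"
        using rep(2)[OF UW] subv[OF v] by simp
      \<comment> \<open>The part of \<open>V\<close> belongs to \<open>R v\<close>, so the signature
        determines this value of \<open>g\<close>.\<close>
      from fun_cong[OF this, of "V \<inter> sub v"]
      show "g v (U \<inter> sub v) (V \<inter> sub v) = g v (U' \<inter> sub v) (V \<inter> sub v)"
        using ER[OF that v] by (simp add: sig_def)
    qed
    show ?thesis
    proof (intro bexI conjI ballI)
      \<comment> \<open>\<open>key\<close> speaks of a given \<open>V\<close>, so some member of
        \<open>E\<close> must exist to apply it.\<close>
      show "U' \<in> interp_verts I t" using key E(3) by blast
      show "U' \<inter> sub v \<in> R' v" if "v \<in> level n" for v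
        using subv[OF that] UW by (auto simp: R'_def)
      show "(U', V) \<in> interp_edges I t \<longleftrightarrow> V \<in> S" if "V \<in> E" for V
        using key[OF that] U(2) that by blast
    qed
  qed
  then obtain w where w: "\<And>S. S \<subseteq> E \<Longrightarrow> w S \<in> interp_verts I t"
    "\<And>S v. S \<subseteq> E \<Longrightarrow> v \<in> level n \<Longrightarrow> w S \<inter> sub v \<in> R' v"
    "\<And>S V. S \<subseteq> E \<Longrightarrow> V \<in> E \<Longrightarrow> (w S, V) \<in> interp_edges I t \<longleftrightarrow> V \<in> S"
    by metis
  have "inj_on w (Pow E)"
  proof (rule inj_onI)
    fix S S' assume S: "S \<in> Pow E" "S' \<in> Pow E" and "w S = w S'"
    then have "V \<in> S \<longleftrightarrow> V \<in> S'" if "V \<in> E" for V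
      using w(3)[of S V] w(3)[of S' V] that by auto
    then show "S = S'" using S by auto
  qed
  then have "card (w ` Pow E) = 2 ^ card E"
    using E(1) by (simp add: card_image card_Pow)
  then show ?thesis
    using E(1) w R' by (intro exI[of _ "w ` Pow E"] exI[of _ R']) auto
qed

text \<open>The order of choices matters: \<open>N\<close> depends on \<open>C\<close>, the initial
  family on \<open>N\<close>, the depth \<open>n\<close> on that family, and finally the height
  \<open>k\<close> on \<open>n\<close>. This is not circular because \<open>C\<close> is fixed
  before \<open>n\<close>.\<close>

lemma interp_graph_not_shattering:
  assumes inf: "infinite (interp_verts I t)"
  shows "\<not> shattering (interp_graph I t)"
proof
  assume shat: "shattering (interp_graph I t)"
  obtain C :: "nat set" and g where C: "finite C" and gC: "\<And>v P Q. g v P Q \<in> C"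
    and comp: "\<And>n U U' V. finite U' \<Longrightarrow> U' \<subseteq> dom t \<Longrightarrow> U \<in> interp_verts I t \<Longrightarrow>
       U \<inter> low n = U' \<inter> low n \<Longrightarrow>
       (\<And>v. v \<in> level n \<Longrightarrow> g v (U \<inter> sub v) (V \<inter> sub v) = g v (U' \<inter> sub v) (V \<inter> sub v)) \<Longrightarrow>
       U' \<in> interp_verts I t \<and> ((U, V) \<in> interp_edges I t \<longleftrightarrow> (U', V) \<in> interp_edges I t)"
    using interp_composition[of t I] by metis
  define d where "d = card C"
  have d: "card C \<le> 2 ^ d" unfolding d_def using less_exp[of "card C"] by simp
  define N where "N = 2 * d + 2"
  obtain E0 where E0: "finite E0" "card E0 = N" "E0 \<subseteq> interp_verts I t"
    using infinite_arbitrarily_large[OF inf] by blast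
  then have "finite (\<Union> E0)" by (auto simp: interp_verts_def)
  then have "finite (length ` \<Union> E0)" by simp
  then obtain n where "\<forall>k \<in> length ` \<Union> E0. k < n" using finite_nat_set_iff_bounded by blast
  then have low: "U \<subseteq> low n" if "U \<in> E0" for U using that by (auto simp: low_def)
  have tower: "\<exists>E R. finite E \<and> E \<subseteq> interp_verts I t \<and> card E = vert_tower N k \<and>
    (\<forall>v \<in> level n. finite (R v) \<and> card (R v) \<le> part_tower d k) \<and>
    (\<forall>U \<in> E. \<forall>v \<in> level n. U \<inter> sub v \<in> R v)" for k
  proof (induction k)
    case 0
    \<comment> \<open>The initial vertices live in \<open>low n\<close>, so the empty set is their
      only part, matching \<open>part_tower d 0 = 1\<close>.\<close>
    have "U \<inter> sub v = {}" if "U \<in> E0" "v \<in> level n" for U v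
      using low low_sub_disjoint that by blast
    then show ?case using E0 by (intro exI[of _ E0] exI[of _ "\<lambda>_. {{}}"]) auto
  next
    case (Suc k)
    then obtain E R where E: "finite E" "E \<subseteq> interp_verts I t" "card E = vert_tower N k"
      and R: "\<And>v. v \<in> level n \<Longrightarrow> finite (R v) \<and> card (R v) \<le> part_tower d k"
      and ER: "\<And>U v. U \<in> E \<Longrightarrow> v \<in> level n \<Longrightarrow> U \<inter> sub v \<in> R v"
      by metis
    have "E \<noteq> {}" using vert_tower_ge[of d k] E(3) by (auto simp: N_def)
    have "\<exists>E' R'. finite E' \<and> E' \<subseteq> interp_verts I t \<and> card E' = 2 ^ card E \<and>
      (\<forall>v \<in> level n. finite (R' v) \<and> card (R' v) \<le> 2 ^ (d * part_tower d k)) \<and>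
      (\<forall>U \<in> E'. \<forall>v \<in> level n. U \<inter> sub v \<in> R' v)"
      by (rule shattering_step[where g = g, OF shat C d gC _ E(1,2) \<open>E \<noteq> {}\<close> R ER]) (rule comp)
    then show ?case by (simp add: E(3))
  qed
  have "vert_tower N k \<le> 2 ^ card (low n) * part_tower d k ^ card (level n)" for k
    using tower[of k] card_le_of_parts by metis
  then show False
    using vert_tower_dominates[of "card (low n)" d "card (level n)"] by (auto simp: N_def not_less[symmetric])
qed

section \<open>The random graph and its isomorphic copies\<close>

lemma random_graph_shattering: "random_graph G \<Longrightarrow> shattering G"
  unfolding shattering_def
proof (intro allI impI)
  fix E S assume G: "random_graph G" and E: "finite E" "E \<subseteq> fst G" "S \<subseteq> E"
  have "finite S \<and> finite (E - S) \<and> S \<subseteq> fst G \<and> E - S \<subseteq> fst G \<and> S \<inter> (E - S) = {}"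
    using E finite_subset by blast
  then obtain v where "v \<in> fst G" "\<forall>x \<in> S. (v, x) \<in> snd G" "\<forall>x \<in> E - S. (v, x) \<notin> snd G"
    using G unfolding random_graph_def by metis
  then show "\<exists>v \<in> fst G. \<forall>x \<in> E. (v, x) \<in> snd G \<longleftrightarrow> x \<in> S" by blast
qed

text \<open>In a finite graph, the whole vertex set would have a common neighbour, hence a loop.\<close>

lemma random_graph_infinite:
  assumes "random_graph G"
  shows "infinite (fst G)"
proof
  assume "finite (fst G)"
  then obtain v where "v \<in> fst G" "\<forall>x \<in> fst G. (v, x) \<in> snd G \<longleftrightarrow> x \<in> fst G"
    using random_graph_shattering[OF assms] unfolding shattering_def by blast
  then show False using assms unfolding random_graph_def irrefl_def by blast
qed

lemma shattering_iso:
  assumes "graph_iso H G" "shattering G"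
  shows "shattering H"
  unfolding shattering_def
proof (intro allI impI)
  obtain f where f: "bij_betw f (fst H) (fst G)"
    "\<And>x y. x \<in> fst H \<Longrightarrow> y \<in> fst H \<Longrightarrow> (x, y) \<in> snd H \<longleftrightarrow> (f x, f y) \<in> snd G"
    using assms(1) unfolding graph_iso_def by blast
  fix E S assume E: "finite E" "E \<subseteq> fst H" "S \<subseteq> E"
  have "finite (f ` E)" "f ` E \<subseteq> fst G" "f ` S \<subseteq> f ` E"
    using E f(1) bij_betw_imp_surj_on by blast+
  then obtain w where w: "w \<in> fst G" "\<forall>y \<in> f ` E. (w, y) \<in> snd G \<longleftrightarrow> y \<in> f ` S"
    using assms(2) unfolding shattering_def by metis
  obtain v where v: "v \<in> fst H" "w = f v" using w(1) f(1) bij_betw_imp_surj_on by blast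
  have "(v, x) \<in> snd H \<longleftrightarrow> x \<in> S" if "x \<in> E" for x
  proof -
    \<comment> \<open>Injectivity of \<open>f\<close> keeps vertices outside \<open>S\<close> out of
      the image of \<open>S\<close>.\<close>
    have "f x \<in> f ` S \<longleftrightarrow> x \<in> S"
      using f(1) E that by (intro inj_on_image_mem_iff[of f "fst H"]) (auto simp: bij_betw_def)
    then show ?thesis using f(2)[OF v(1), of x] w(2) v(2) E that by auto
  qed
  then show "\<exists>v \<in> fst H. \<forall>x \<in> E. (v, x) \<in> snd H \<longleftrightarrow> x \<in> S" using v by blast
qed

theorem theorem5p4:
  fixes G :: "'v graph"
  assumes "random_graph G"
  shows "\<not> (\<exists>(t :: 'a::finite tree) (I :: 'a fs_interp).
            is_tree t \<and> finite_sets_interp I \<and> graph_iso (interp_graph I t) G)"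
proof
  assume "\<exists>(t :: 'a tree) (I :: 'a fs_interp).
    is_tree t \<and> finite_sets_interp I \<and> graph_iso (interp_graph I t) G"
  then obtain t :: "'a tree" and I :: "'a fs_interp" where iso: "graph_iso (interp_graph I t) G"
    by blast
  have "infinite (fst (interp_graph I t))"
    using iso random_graph_infinite[OF assms] bij_betw_finite unfolding graph_iso_def by blast
  then show False
    using interp_graph_not_shattering[of I t] shattering_iso[OF iso random_graph_shattering[OF assms]]
    by (simp add: interp_graph_def)
qed

end
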